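(* There is a sentence $\psi$ of $\mathsf{InqBT}+[x]$ in the empty vocabulary (only identity) which defines finiteness, i.e., such that for every model $\mathcal{M}$: $\mathcal{M}\models\psi$ if and only if the domain of $\mathcal{M}$ is finite.
   Context: Syntax of $\mathsf{InqBT}+[x]$: $\phi ::= p \mid \bot \mid (\phi\wedge\phi)\mid(\phi\veebar\phi)\mid(\phi\to\phi)\mid\forall x\phi\mid\exists^{\mathrm{i}}x\phi\mid[x]\phi$, where $p$ ranges over first-order atomic formulas ($t_1=t_2$ or $P(t_1,\dots,t_n)$), $\veebar$ is inquisitive disjunction and $\exists^{\mathrm{i}}$ the inquisitive existential. Abbreviations: $\neg\phi:=\phi\to\bot$, $t_1\neq t_2:=\neg(t_1=t_2)$. A model $\mathcal{M}=(D,I)$ is an ordinary first-order structure with non-empty domain $D$. A team $X$ is a set of assignments with a common domain of variables $\mathrm{dom}(X)$. For an assignment $g$, $g[x\mapsto d]$ agrees with $g$ except it maps $x$ to $d$; $X[x\mapsto d]=\{g[x\mapsto d]: g\in X\}$ and $X[x\mapsto D]=\{g[x\mapsto d]: g\in X, d\in D\}$. Support $\mathcal{M}\models_X\phi$ (for $\mathrm{dom}(X)$ containing the free variables of $\phi$): $\mathcal{M}\models_X p$ iff every $g\in X$ satisfies $p$ in Tarskian semantics; $\mathcal{M}\models_X\bot$ iff $X=\emptyset$; $\wedge$ is conjunction of support; $\mathcal{M}\models_X\phi\veebar\psi$ iff $\mathcal{M}\models_X\phi$ or $\mathcal{M}\models_X\psi$; $\mathcal{M}\models_X\phi\to\psi$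 iff for all $Y\subseteq X$, $\mathcal{M}\models_Y\phi$ implies $\mathcal{M}\models_Y\psi$; $\mathcal{M}\models_X\forall x\phi$ iff $\mathcal{M}\models_{X[x\mapsto d]}\phi$ for all $d\in D$; $\mathcal{M}\models_X\exists^{\mathrm{i}}x\phi$ iff $\mathcal{M}\models_{X[x\mapsto d]}\phi$ for some $d\in D$; $\mathcal{M}\models_X[x]\phi$ iff $\mathcal{M}\models_{X[x\mapsto D]}\phi$. For a sentence $\phi$, support does not depend on which non-empty team is used; $\mathcal{M}\models\phi$ means $\mathcal{M}\models_X\phi$ for some (equivalently every) non-empty team $X$. *)

theory Defs
  imports Main
begin

type_synonym var = nat

text \<open>Terms and formulas over function symbols \<open>'f\<close> and predicate symbols \<open>'p\<close>.  Symbols carry no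
  declared arity: a symbol applied to different numbers of arguments acts as different symbols.
  The set functions of the datatypes collect the non-logical symbols that occur.\<close>

datatype (tm_funs: 'f) tm = Var var | Fun 'f "'f tm list"

datatype (fm_funs: 'f, fm_preds: 'p) fm =
    Eq "'f tm" "'f tm"
  | Pred 'p "'f tm list"
  | Bot
  | Conj "('f, 'p) fm" "('f, 'p) fm"
  | IDisj "('f, 'p) fm" "('f, 'p) fm"
  | Imp "('f, 'p) fm" "('f, 'p) fm"
  | Forall var "('f, 'p) fm"
  | IExists var "('f, 'p) fm"
  | Box var "('f, 'p) fm"

definition Neg :: "('f, 'p) fm \<Rightarrow> ('f, 'p) fm" where
  "Neg \<phi> = Imp \<phi> Bot"

definition Neq :: "'f tm \<Rightarrow> 'f tm \<Rightarrow> ('f, 'p) fm" where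
  "Neq s t = Neg (Eq s t)"

primrec fv_tm :: "'f tm \<Rightarrow> var set" where
  "fv_tm (Var x) = {x}"
| "fv_tm (Fun f ts) = \<Union> (set (map fv_tm ts))"

primrec fv :: "('f, 'p) fm \<Rightarrow> var set" where
  "fv (Eq s t) = fv_tm s \<union> fv_tm t"
| "fv (Pred p ts) = (\<Union>t\<in>set ts. fv_tm t)"
| "fv Bot = {}"
| "fv (Conj \<phi> \<psi>) = fv \<phi> \<union> fv \<psi>"
| "fv (IDisj \<phi> \<psi>) = fv \<phi> \<union> fv \<psi>"
| "fv (Imp \<phi> \<psi>) = fv \<phi> \<union> fv \<psi>"
| "fv (Forall x \<phi>) = fv \<phi> - {x}"
| "fv (IExists x \<phi>) = fv \<phi> - {x}"
| "fv (Box x \<phi>) = fv \<phi> - {x}"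

definition sentence :: "('f, 'p) fm \<Rightarrow> bool" where
  "sentence \<phi> \<longleftrightarrow> fv \<phi> = {}"

definition empty_vocabulary :: "('f, 'p) fm \<Rightarrow> bool" where
  "empty_vocabulary \<phi> \<longleftrightarrow> fm_funs \<phi> = {} \<and> fm_preds \<phi> = {}"

record ('f, 'p, 'a) struct =
  Dom :: "'a set"
  FunI :: "'f \<Rightarrow> 'a list \<Rightarrow> 'a"
  PredI :: "'p \<Rightarrow> 'a list \<Rightarrow> bool"

definition model :: "('f, 'p, 'a) struct \<Rightarrow> bool" where
  "model M \<longleftrightarrow> Dom M \<noteq> {} \<and> (\<forall>f as. set as \<subseteq> Dom M \<longrightarrow> FunI M f as \<in> Dom M)"

text \<open>Assignments are partial maps; a team is a set of assignments into the domain of the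
  structure that share their domain of variables.\<close>

type_synonym 'a asg = "var \<rightharpoonup> 'a"

definition team_on :: "('f, 'p, 'a) struct \<Rightarrow> var set \<Rightarrow> 'a asg set \<Rightarrow> bool" where
  "team_on M V X \<longleftrightarrow> (\<forall>g\<in>X. dom g = V \<and> ran g \<subseteq> Dom M)"

primrec eval :: "('f, 'p, 'a) struct \<Rightarrow> 'a asg \<Rightarrow> 'f tm \<Rightarrow> 'a" where
  "eval M g (Var x) = the (g x)"
| "eval M g (Fun f ts) = FunI M f (map (eval M g) ts)"

definition team_upd :: "'a asg set \<Rightarrow> var \<Rightarrow> 'a \<Rightarrow> 'a asg set" where
  "team_upd X x d = {g(x \<mapsto> d) | g. g \<in> X}"

definition team_upd_all :: "'a asg set \<Rightarrow> var \<Rightarrow> 'a set \<Rightarrow> 'a asg set" where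
  "team_upd_all X x D = {g(x \<mapsto> d) | g d. g \<in> X \<and> d \<in> D}"

text \<open>Meaningful only for teams on a set of variables that contains the free variables of the
  formula.\<close>

primrec support :: "('f, 'p, 'a) struct \<Rightarrow> 'a asg set \<Rightarrow> ('f, 'p) fm \<Rightarrow> bool" where
  "support M X (Eq s t) \<longleftrightarrow> (\<forall>g\<in>X. eval M g s = eval M g t)"
| "support M X (Pred p ts) \<longleftrightarrow> (\<forall>g\<in>X. PredI M p (map (eval M g) ts))"
| "support M X Bot \<longleftrightarrow> X = {}"
| "support M X (Conj \<phi> \<psi>) \<longleftrightarrow> support M X \<phi> \<and> support M X \<psi>"
| "support M X (IDisj \<phi> \<psi>) \<longleftrightarrow> support M X \<phi> \<or> support M X \<psi>"
| "support M X (Imp \<phi> \<psi>) \<longleftrightarrow> (\<forall>Y\<subseteq>X. support M Y \<phi> \<longrightarrow> support M Y \<psi>)"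
| "support M X (Forall x \<phi>) \<longleftrightarrow> (\<forall>d\<in>Dom M. support M (team_upd X x d) \<phi>)"
| "support M X (IExists x \<phi>) \<longleftrightarrow> (\<exists>d\<in>Dom M. support M (team_upd X x d) \<phi>)"
| "support M X (Box x \<phi>) \<longleftrightarrow> support M (team_upd_all X x (Dom M)) \<phi>"

definition satisfies :: "('f, 'p, 'a) struct \<Rightarrow> ('f, 'p) fm \<Rightarrow> bool" where
  "satisfies M \<phi> \<longleftrightarrow> (\<exists>V X. team_on M V X \<and> X \<noteq> {} \<and> support M X \<phi>)"

lemma eval_agree: "(\<And>x. x \<in> fv_tm t \<Longrightarrow> g x = h x) \<Longrightarrow> eval M g t = eval M h t"
proof (induction t)
  case (Fun f ts)
  then have "map (eval M g) ts = map (eval M h) ts" by auto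
  then show ?case by (simp only: eval.simps)
qed simp

text \<open>Locality: support depends only on the values of the free variables.\<close>

definition agree :: "var set \<Rightarrow> 'a asg set \<Rightarrow> 'a asg set \<Rightarrow> bool" where
  "agree V X Y \<longleftrightarrow> (\<lambda>g. g |` V) ` X = (\<lambda>g. g |` V) ` Y"

lemma agree_sym: "agree V X Y \<Longrightarrow> agree V Y X"
  by (simp add: agree_def)

lemma agree_mono:
  assumes "agree V X Y" "W \<subseteq> V"
  shows "agree W X Y"
proof -
  have "(\<lambda>g. g |` W) ` Z = (\<lambda>g. g |` W) ` (\<lambda>g. g |` V) ` Z" for Z :: "'a asg set"
    using assms(2) by (simp add: image_image Int_absorb1)
  then show ?thesis using assms(1) unfolding agree_def by metis
qed

lemma agree_subteam:
  assumes "agree V X Y" "Z \<subseteq> X"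
  shows "\<exists>W\<subseteq>Y. agree V Z W"
proof -
  have "(\<lambda>g. g |` V) ` Z \<subseteq> (\<lambda>g. g |` V) ` Y"
    using image_mono[OF assms(2), of "\<lambda>g. g |` V"] assms(1) by (simp add: agree_def)
  then show ?thesis unfolding agree_def by (simp only: subset_image_iff)
qed

lemma agree_upd:
  assumes "agree (V - {x}) X Y"
  shows "agree V (team_upd X x d) (team_upd Y x d)"
proof -
  have "(\<lambda>g. g |` V) ` team_upd Z x d
      = (\<lambda>k. (k(x \<mapsto> d)) |` V) ` (\<lambda>g. g |` (V - {x})) ` Z" for Z :: "'a asg set"
  proof -
    have *: "(g(x \<mapsto> d)) |` V = ((g |` (V - {x}))(x \<mapsto> d)) |` V" for g :: "'a asg"
      by (rule ext) (simp add: restrict_map_def)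
    have **: "team_upd Z x d = (\<lambda>g. g(x \<mapsto> d)) ` Z"
      by (simp add: team_upd_def Setcompr_eq_image)
    show ?thesis
      unfolding ** image_image by (rule image_cong[OF refl *])
  qed
  note * = this
  show ?thesis using assms unfolding agree_def * by (rule arg_cong)
qed

lemma agree_upd_all:
  assumes "agree (V - {x}) X Y"
  shows "agree V (team_upd_all X x D) (team_upd_all Y x D)"
proof -
  have "team_upd_all Z x D = (\<Union>d\<in>D. team_upd Z x d)" for Z :: "'a asg set"
    unfolding team_upd_all_def team_upd_def by auto
  then show ?thesis using agree_upd[OF assms] by (simp add: agree_def image_UN)
qed

lemma agree_witness:
  assumes "agree V X Y" "h \<in> Y"
  shows "\<exists>g\<in>X. \<forall>x\<in>V. g x = h x"
proof -
  have "h |` V \<in> (\<lambda>g. g |` V) ` X"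
    using assms by (simp add: agree_def)
  then obtain g where g: "g \<in> X" "h |` V = g |` V" by (rule imageE)
  have "g x = h x" if "x \<in> V" for x
    using fun_cong[OF g(2), of x] that by simp
  then show ?thesis by (intro bexI[OF _ g(1)] ballI)
qed

lemma support_agree:
  "agree (fv \<phi>) X Y \<Longrightarrow> support M X \<phi> \<longleftrightarrow> support M Y \<phi>"
proof (induct \<phi> arbitrary: X Y)
  case (Eq s t)
  have *: "support M Y (Eq s t)"
    if a: "agree (fv_tm s \<union> fv_tm t) X Y" and s: "support M X (Eq s t)" for X Y
    unfolding support.simps
  proof
    fix h assume "h \<in> Y"
    obtain g where g: "g \<in> X" "\<forall>x\<in>fv_tm s \<union> fv_tm t. g x = h x"
      using agree_witness[OF a \<open>h \<in> Y\<close>] by (rule bexE) (rule that)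
    have "eval M g s = eval M h s" "eval M g t = eval M h t"
      by (rule eval_agree, rule g(2)[rule_format], simp)+
    then show "eval M h s = eval M h t" using s g(1) by simp
  qed
  have "agree (fv_tm s \<union> fv_tm t) X Y" using Eq by simp
  then show ?case using * agree_sym by blast
next
  case (Pred p ts)
  have *: "support M Y (Pred p ts)"
    if a: "agree (fv (Pred p ts)) X Y" and s: "support M X (Pred p ts)" for X Y
    unfolding support.simps
  proof
    fix h assume "h \<in> Y"
    obtain g where g: "g \<in> X" "\<forall>x\<in>fv (Pred p ts). g x = h x"
      using agree_witness[OF a \<open>h \<in> Y\<close>] by (rule bexE) (rule that)
    have "map (eval M g) ts = map (eval M h) ts"
      by (rule map_cong[OF refl], rule eval_agree, rule g(2)[rule_format]) auto
    moreover have "PredI M p (map (eval M g) ts)" using s g(1) by simp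
    ultimately show "PredI M p (map (eval M h) ts)" by (simp only:)
  qed
  show ?case using *[OF Pred] *[OF agree_sym[OF Pred]] by (rule iffI)
next
  case Bot
  then show ?case unfolding agree_def by auto
next
  case (Conj \<phi> \<psi>)
  have "agree (fv \<phi>) X Y" "agree (fv \<psi>) X Y"
    using agree_mono[OF Conj.prems] by auto
  then show ?case using Conj.hyps by simp
next
  case (IDisj \<phi> \<psi>)
  have "agree (fv \<phi>) X Y" "agree (fv \<psi>) X Y"
    using agree_mono[OF IDisj.prems] by auto
  then show ?case using IDisj.hyps by simp
next
  case (Imp \<phi> \<psi>)
  have *: "support M Y (Imp \<phi> \<psi>)"
    if a: "agree (fv (Imp \<phi> \<psi>)) X Y" and s: "support M X (Imp \<phi> \<psi>)" for X Y
    unfolding support.simps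
  proof (intro allI impI)
    fix Z assume Z: "Z \<subseteq> Y" "support M Z \<phi>"
    obtain W where W: "W \<subseteq> X" "agree (fv (Imp \<phi> \<psi>)) Z W"
      using agree_subteam[OF agree_sym[OF a] Z(1)] by blast
    have "agree (fv \<phi>) Z W" "agree (fv \<psi>) Z W" using agree_mono[OF W(2)] by auto
    then show "support M Z \<psi>" using Imp.hyps s W(1) Z(2) by simp
  qed
  show ?case using *[OF Imp.prems] *[OF agree_sym[OF Imp.prems]] by blast
next
  case (Forall x \<phi>)
  have "agree (fv \<phi> - {x}) X Y" using Forall.prems by simp
  note Forall.hyps[OF agree_upd[OF this]]
  then show ?case by (simp only: support.simps)
next
  case (IExists x \<phi>)
  have "agree (fv \<phi> - {x}) X Y" using IExists.prems by simp
  note IExists.hyps[OF agree_upd[OF this]]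
  then show ?case by (simp only: support.simps)
next
  case (Box x \<phi>)
  have "agree (fv \<phi> - {x}) X Y" using Box.prems by simp
  note Box.hyps[OF agree_upd_all[OF this]]
  then show ?case by (simp only: support.simps)
qed

text \<open>For a sentence, support by some and by every non-empty team amount to the same.\<close>

lemma satisfies_iff_every_team:
  assumes "sentence \<phi>"
  shows "satisfies M \<phi> \<longleftrightarrow> (\<forall>V X. team_on M V X \<and> X \<noteq> {} \<longrightarrow> support M X \<phi>)"
proof -
  have "support M X \<phi> \<longleftrightarrow> support M Y \<phi>" if "X \<noteq> {}" "Y \<noteq> {}" for X Y
    using that assms by (intro support_agree) (auto simp: sentence_def agree_def)
  moreover have "team_on M {} {Map.empty}" by (simp add: team_on_def)
  ultimately show ?thesis unfolding satisfies_def by (metis insert_not_empty)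
qed

text \<open>\<open>Determines x y z\<close> (with \<open>z\<close> distinct from \<open>x\<close> and \<open>y\<close>) says that in the team the value of \<open>x\<close>
  functionally determines that of \<open>y\<close>: a subteam on which \<open>x\<close> is constant has \<open>y\<close> constant.\<close>

definition Determines :: "var \<Rightarrow> var \<Rightarrow> var \<Rightarrow> ('f, 'p) fm" where
  "Determines x y z =
     Imp (IExists z (Eq (Var x) (Var z))) (IExists z (Eq (Var y) (Var z)))"

text \<open>With \<open>x, y, z\<close> the variables 0, 1, 2: the two boxes create the team of all pairs of elements
  of the domain, whose subteams are the binary relations on it.  The sentence says that every
  one-to-one relation whose range misses an element has a domain that misses an element.  The
  sentence is a constant because a sentence bound by an existential quantifier inside a theorem
  about structures over a type \<open>'a\<close> could depend on \<open>'a\<close>; this one serves structures over all types.\<close>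

definition finiteness_sentence :: "('f, 'p) fm" where
  "finiteness_sentence =
     Box 0 (Box 1 (Imp
       (Conj (Conj (Determines 0 1 2) (Determines 1 0 2)) (IExists 2 (Neq (Var 1) (Var 2))))
       (IExists 2 (Neq (Var 0) (Var 2)))))"

end

theory Submission
  imports Defs
begin

text \<open>The two boxes produce the team of all pairs from the domain, so the sentence asserts that every
  injection from the domain into itself is onto: Dedekind's characterisation of finiteness.\<close>

text \<open>By locality all non-empty teams look alike to a sentence, so one concrete team suffices.
  The empty assignment is the convenient choice: after two boxes its extensions carry values for 0
  and 1 only.\<close>

lemma satisfies_iff_empty_assignment:
  assumes "sentence \<phi>"
  shows "satisfies M \<phi> \<longleftrightarrow> support M {Map.empty} \<phi>"
proof -
  have "support M X \<phi> \<longleftrightarrow> support M {Map.empty} \<phi>" if "X \<noteq> {}" for X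
    using that assms by (intro support_agree) (auto simp: sentence_def agree_def)
  moreover have "team_on M {} {Map.empty}" by (simp add: team_on_def)
  ultimately show ?thesis unfolding satisfies_def by blast
qed

lemma team_upd_image: "team_upd X x d = (\<lambda>g. g(x \<mapsto> d)) ` X"
  by (auto simp: team_upd_def)

text \<open>The inquisitive existential picks a single value for the whole team, so this formula
  expresses constancy of \<open>x\<close>. Since \<open>x\<close> differs from \<open>z\<close>, the
  update of \<open>z\<close> leaves \<open>x\<close> untouched.\<close>

lemma support_IExists_Eq:
  assumes "x \<noteq> z"
  shows "support M X (IExists z (Eq (Var x) (Var z))) \<longleftrightarrow> (\<exists>d\<in>Dom M. \<forall>g\<in>X. the (g x) = d)"
  using assms by (simp add: team_upd_image)

text \<open>Negation rules out every non-empty subteam supporting the equation, and singleton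
  subteams already detect a violation. Hence \<open>Neq\<close> behaves pointwise.\<close>

lemma support_Neq: "support M X (Neq s t) \<longleftrightarrow> (\<forall>g\<in>X. eval M g s \<noteq> eval M g t)"
proof
  assume *: "support M X (Neq s t)"
  show "\<forall>g\<in>X. eval M g s \<noteq> eval M g t"
  proof (intro ballI notI)
    fix g assume "g \<in> X" "eval M g s = eval M g t"
    then have "{g} \<subseteq> X" "support M {g} (Eq s t)" by auto
    then show False using * by (auto simp: Neq_def Neg_def)
  qed
qed (auto simp: Neq_def Neg_def)

lemma support_IExists_Neq:
  assumes "x \<noteq> z"
  shows "support M X (IExists z (Neq (Var x) (Var z))) \<longleftrightarrow> (\<exists>d\<in>Dom M. \<forall>g\<in>X. the (g x) \<noteq> d)"
  using assms by (simp add: team_upd_image support_Neq)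

text \<open>Constancy on subteams is tested by pairs: a two-element subteam yields the functional
  dependence, and conversely any member of a non-empty subteam supplies the common value of
  \<open>y\<close>.\<close>

lemma support_Determines:
  assumes "x \<noteq> z" "y \<noteq> z" "Dom M \<noteq> {}"
    and "\<And>g. g \<in> X \<Longrightarrow> the (g x) \<in> Dom M \<and> the (g y) \<in> Dom M"
  shows "support M X (Determines x y z) \<longleftrightarrow>
    (\<forall>g\<in>X. \<forall>h\<in>X. the (g x) = the (h x) \<longrightarrow> the (g y) = the (h y))" (is "?L \<longleftrightarrow> ?R")
proof -
  have L: "?L \<longleftrightarrow> (\<forall>Y\<subseteq>X. (\<exists>d\<in>Dom M. \<forall>g\<in>Y. the (g x) = d) \<longrightarrow> (\<exists>d\<in>Dom M. \<forall>g\<in>Y. the (g y) = d))"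
    unfolding Determines_def support.simps(6)
      support_IExists_Eq[OF assms(1)] support_IExists_Eq[OF assms(2)] ..
  show ?thesis
  proof
    assume ?L
    show ?R
    proof (intro ballI impI)
      fix g h assume gh: "g \<in> X" "h \<in> X" "the (g x) = the (h x)"
      have "\<exists>d\<in>Dom M. \<forall>k\<in>{g, h}. the (k x) = d" using gh assms(4) by auto
      moreover have "{g, h} \<subseteq> X" using gh by simp
      ultimately have "\<exists>d\<in>Dom M. \<forall>k\<in>{g, h}. the (k y) = d"
        using \<open>?L\<close>[unfolded L, rule_format, of "{g, h}"] by (simp only:)
      then show "the (g y) = the (h y)" by auto
    qed
  next
    assume R: ?R
    show ?L unfolding L
    proof (intro allI impI)
      fix Y assume Y: "Y \<subseteq> X" "\<exists>d\<in>Dom M. \<forall>g\<in>Y. the (g x) = d"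
      show "\<exists>d\<in>Dom M. \<forall>g\<in>Y. the (g y) = d"
      proof (cases "Y = {}")
        case True
        \<comment> \<open>Even on the empty team the existential needs a witness, which a non-empty
          domain provides.\<close>
        then show ?thesis using assms(3) by auto
      next
        case False
        then obtain h where "h \<in> Y" by blast
        moreover have "\<forall>g\<in>Y. the (g y) = the (h y)" using R Y \<open>h \<in> Y\<close> by (metis subsetD)
        ultimately show ?thesis using assms(4) Y(1) by blast
      qed
    qed
  qed
qed

lemma sentence_finiteness_sentence: "sentence finiteness_sentence"
  by (auto simp: sentence_def finiteness_sentence_def Determines_def Neq_def Neg_def)

lemma empty_vocabulary_finiteness_sentence: "empty_vocabulary finiteness_sentence"
  by (auto simp: empty_vocabulary_def finiteness_sentence_def Determines_def Neq_def Neg_def)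

text \<open>The implication ranges over subteams of the team of all pairs, and these are the binary
  relations between the values of 0 and 1. The two dependences merge into one equivalence: the
  relation is one-to-one.\<close>

lemma satisfies_finiteness_sentence_iff:
  fixes M :: "('f, 'p, 'a) struct"
  assumes "Dom M \<noteq> {}"
  shows "satisfies M finiteness_sentence \<longleftrightarrow>
    (\<forall>Y \<subseteq> {[0 \<mapsto> a, Suc 0 \<mapsto> b] | a b. a \<in> Dom M \<and> b \<in> Dom M}.
      (\<forall>g\<in>Y. \<forall>h\<in>Y. the (g 0) = the (h 0) \<longleftrightarrow> the (g 1) = the (h 1)) \<longrightarrow>
      (\<exists>d\<in>Dom M. \<forall>g\<in>Y. the (g 1) \<noteq> d) \<longrightarrow> (\<exists>d\<in>Dom M. \<forall>g\<in>Y. the (g 0) \<noteq> d))"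
proof -
  let ?T = "{[0 \<mapsto> a, Suc 0 \<mapsto> b] | a b. a \<in> Dom M \<and> b \<in> Dom M}"
  have T: "team_upd_all (team_upd_all {Map.empty} 0 (Dom M)) 1 (Dom M) = ?T"
    unfolding team_upd_all_def by auto
  have D: "support M Y (Conj (Determines 0 1 2) (Determines 1 0 2)) \<longleftrightarrow>
      (\<forall>g\<in>Y. \<forall>h\<in>Y. the (g 0) = the (h 0) \<longleftrightarrow> the (g 1) = the (h 1))" if "Y \<subseteq> ?T" for Y
  proof -
    have V: "the (g 0) \<in> Dom M \<and> the (g 1) \<in> Dom M" if "g \<in> Y" for g
      using \<open>Y \<subseteq> ?T\<close> that by auto
    have "support M Y (Determines 0 1 2) \<longleftrightarrow>
        (\<forall>g\<in>Y. \<forall>h\<in>Y. the (g 0) = the (h 0) \<longrightarrow> the (g 1) = the (h 1))"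
      by (rule support_Determines) (use assms V in auto)
    moreover have "support M Y (Determines 1 0 2) \<longleftrightarrow>
        (\<forall>g\<in>Y. \<forall>h\<in>Y. the (g 1) = the (h 1) \<longrightarrow> the (g 0) = the (h 0))"
      by (rule support_Determines) (use assms V in auto)
    ultimately show ?thesis
      unfolding support.simps(4) by blast
  qed
  have z: "(0::nat) \<noteq> 2" "(1::nat) \<noteq> 2" by simp_all
  show ?thesis
    unfolding satisfies_iff_empty_assignment[OF sentence_finiteness_sentence]
    \<comment> \<open>The instance of \<open>support.simps(4)\<close> splits only the outer
      conjunction. The inner one stays whole for \<open>D\<close>, whose premise that
      \<open>Y\<close> is a subteam comes from \<open>all_cong\<close>.\<close>
    unfolding finiteness_sentence_def support.simps(9) T support.simps(6)
      support.simps(4)[of _ _ "Conj _ _"]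
      support_IExists_Neq[OF z(1)] support_IExists_Neq[OF z(2)]
    by (intro all_cong) (simp only: D imp_conjL)
qed

text \<open>A one-to-one relation that uses every element as a first value is the graph of an
  injection of the domain into itself, which links the condition on relations to surjectivity of
  injections.\<close>

lemma satisfies_finiteness_sentence_iff_finite:
  fixes M :: "('f, 'p, 'a) struct"
  assumes "Dom M \<noteq> {}"
  shows "satisfies M finiteness_sentence \<longleftrightarrow> finite (Dom M)"
proof
  assume fin: "finite (Dom M)"
  show "satisfies M finiteness_sentence"
    unfolding satisfies_finiteness_sentence_iff[OF assms]
  proof (intro allI impI)
    fix Y :: "'a asg set"
    assume Y: "Y \<subseteq> {[0 \<mapsto> a, Suc 0 \<mapsto> b] | a b. a \<in> Dom M \<and> b \<in> Dom M}"
      and one: "\<forall>g\<in>Y. \<forall>h\<in>Y. the (g 0) = the (h 0) \<longleftrightarrow> the (g 1) = the (h 1)"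
      and "\<exists>d\<in>Dom M. \<forall>g\<in>Y. the (g 1) \<noteq> d"
    then obtain e where e: "e \<in> Dom M" "\<forall>g\<in>Y. the (g 1) \<noteq> e" by blast
    show "\<exists>d\<in>Dom M. \<forall>g\<in>Y. the (g 0) \<noteq> d"
    proof (rule ccontr)
      assume "\<not> ?thesis"
      then have "\<forall>d\<in>Dom M. \<exists>g\<in>Y. the (g 0) = d" by blast
      \<comment> \<open>If no element is missed as a first value, choosing for each \<open>d\<close>
        an assignment with first value \<open>d\<close> turns \<open>Y\<close> into a self-map of
        the domain. It is injective by \<open>one\<close>, hence onto by finiteness, and so it hits
        the missed value \<open>e\<close>.\<close>
      then obtain G where G: "\<And>d. d \<in> Dom M \<Longrightarrow> G d \<in> Y \<and> the (G d 0) = d" by metis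
      let ?f = "\<lambda>d. the (G d 1)"
      have "inj_on ?f (Dom M)" by (rule inj_onI) (metis G one)
      moreover have "?f ` Dom M \<subseteq> Dom M" using G Y by fastforce
      ultimately have "?f ` Dom M = Dom M" by (intro endo_inj_surj fin)
      then have "e \<in> ?f ` Dom M" using e(1) by (simp only:)
      then obtain d where "d \<in> Dom M" "?f d = e" by blast
      then show False using G e(2) by blast
    qed
  qed
next
  assume sat: "satisfies M finiteness_sentence"
  show "finite (Dom M)"
  proof (rule ccontr)
    assume inf: "infinite (Dom M)"
    obtain e where e: "e \<in> Dom M" using assms by blast
    \<comment> \<open>Removing one point from an infinite set does not change its
      cardinality.\<close>
    obtain f where f: "bij_betw f (Dom M) (Dom M - {e})"
      using infinite_imp_bij_betw[OF inf] by blast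
    then have fD: "f a \<in> Dom M" "f a \<noteq> e" if "a \<in> Dom M" for a
      using that bij_betwE by blast+
    \<comment> \<open>The graph of \<open>f\<close> as a team is the counterexample: its second
      values miss \<open>e\<close>, while its first values exhaust the domain.\<close>
    let ?Y = "(\<lambda>a. [0 \<mapsto> a, Suc 0 \<mapsto> f a]) ` Dom M"
    have "?Y \<subseteq> {[0 \<mapsto> a, Suc 0 \<mapsto> b] | a b. a \<in> Dom M \<and> b \<in> Dom M}"
      using fD by blast
    moreover have "\<forall>g\<in>?Y. \<forall>h\<in>?Y. the (g 0) = the (h 0) \<longleftrightarrow> the (g 1) = the (h 1)"
      using bij_betw_imp_inj_on[OF f] by (auto dest: inj_onD)
    moreover have "\<exists>d\<in>Dom M. \<forall>g\<in>?Y. the (g 1) \<noteq> d"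
      using e fD by auto
    ultimately have "\<exists>d\<in>Dom M. \<forall>g\<in>?Y. the (g 0) \<noteq> d"
      using sat unfolding satisfies_finiteness_sentence_iff[OF assms] by blast
    then show False by auto
  qed
qed

theorem theorem1:
  shows "sentence (finiteness_sentence :: ('f, 'p) fm) \<and>
    empty_vocabulary (finiteness_sentence :: ('f, 'p) fm) \<and>
    (\<forall>M :: ('f, 'p, 'a) struct. model M \<longrightarrow>
      (satisfies M (finiteness_sentence :: ('f, 'p) fm) \<longleftrightarrow> finite (Dom M)))"
  by (simp add: sentence_finiteness_sentence empty_vocabulary_finiteness_sentence
      satisfies_finiteness_sentence_iff_finite model_def)

end
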